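(* There exists $k_0\in\mathbb N$ such that for all $k,j\in\mathbb N$ with $j\ge k\ge k_0$, $$p^{(j)}_j\le p^{(k)}_k\,\log^{2(j-k+1)\log(j-k+1)}p^{(k)}_k.$$
   Context: Let $p_n$ denote the $n$-th prime number. Define $p^{(0)}_n=n$ and recursively $p^{(k+1)}_n=p_{p^{(k)}_n}$ for $k\in\mathbb N_0$. $\log$ is the natural logarithm and $\log^t y=(\log y)^t$. *)

theory Defs
  imports "HOL-Analysis.Analysis" "HOL-Computational_Algebra.Primes"
begin

text \<open>The n-th prime, 1-indexed: nth_prime 1 = 2, nth_prime 2 = 3, ...
  (nth_prime 0 is a junk value, never used by the statement).\<close>
definition nth_prime :: "nat \<Rightarrow> nat" where
  "nth_prime n = enumerate {p. prime p} (n - 1)"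

definition iter_prime :: "nat \<Rightarrow> nat \<Rightarrow> nat" where
  "iter_prime k n = (nth_prime ^^ k) n"

end

theory Submission
  imports Defs "HOL-Real_Asymp.Real_Asymp"
begin

text \<open>
  Write \<open>P\<close> for the \<open>k\<close>-fold iterate at \<open>k\<close> and put \<open>j = k + m\<close>. Since the \<open>n\<close>-th prime exceeds
  \<open>n\<close>, the \<open>m\<close>-fold iterate at \<open>k\<close> is at least \<open>k + m\<close>; by monotonicity the \<open>j\<close>-fold iterate at
  \<open>j\<close> is therefore at most the \<open>2m\<close>-fold iterate at \<open>P\<close>. One iteration multiplies \<open>n\<close> by at most
  \<open>(ln n) powr (11/10)\<close> for large \<open>n\<close>, so this costs an exponent of roughly \<open>11/5 * m\<close>, which for
  \<open>m \<ge> 1\<close> is below \<open>2 * (m + 1) * ln (m + 1)\<close>. Hence no asymptotics of prime gaps and no prime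
  number theorem are needed, only Chebyshev's upper bound for the \<open>n\<close>-th prime. The latter follows
  from \<open>2 ^ n \<le> (n + 1) * Lcm {1..n}\<close>.
\<close>

section \<open>Counting primes through the least common multiple of \<open>1..n\<close>\<close>

text \<open>Divisibility of \<open>d = Lcm {1..N}\<close> by \<open>x\<close> means that
  \<open>d / x\<close> is an integer. Column \<open>Suc k\<close> of the reciprocals of
  \<open>k * (n choose k)\<close> consists of differences of entries of column \<open>k\<close> from
  rows \<open>n - 1\<close> and \<open>n\<close>, so integrality passes from column to
  column.\<close>

lemma mult_choose_dvd_Lcm:
  fixes k n N :: nat
  assumes "1 \<le> k" "k \<le> n" "n \<le> N"
  shows "k * (n choose k) dvd Lcm {1..N}"
  using assms
proof (induction k arbitrary: n rule: nat_induct_at_least)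
  case base
  then show ?case by (auto intro!: dvd_Lcm)
next
  case (Suc k)
  define d where "d = real (Lcm {1..N})"
  have Ints_iff: "x dvd Lcm {1..N} \<longleftrightarrow> d / real x \<in> \<int>" if "x > 0" for x
  proof
    assume "x dvd Lcm {1..N}"
    then obtain c where "Lcm {1..N} = x * c" by blast
    then have "d / real x = real c" using that by (simp add: d_def)
    then show "d / real x \<in> \<int>" by simp
  next
    assume "d / real x \<in> \<int>"
    then obtain c :: int where "d / real x = of_int c" by (auto elim: Ints_cases)
    then have "d = of_int (c * int x)" using that by (simp add: field_simps)
    then have "int (Lcm {1..N}) = c * int x" unfolding d_def
      by (metis of_int_eq_iff of_int_of_nat_eq)
    then show "x dvd Lcm {1..N}"
      by (metis dvd_triv_right int_dvd_int_iff)
  qed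
  obtain n' where n: "n = Suc n'" using Suc.prems by (cases n) auto
  have k: "k \<ge> 1" "k \<le> n'" using Suc n by auto
  define A where "A = real (n' choose k)"
  define B where "B = real (n choose k)"
  have pos: "A > 0" "B > 0" using k n by (auto simp: A_def B_def)
  have "Suc n' * (n' choose k) = (Suc n' choose Suc k) * Suc k"
    by (rule Suc_times_binomial_eq)
  then have 1: "real (Suc k) * real (n choose Suc k) = real n * A"
    unfolding A_def n by (metis mult.commute of_nat_mult)
  have "real n * A = (real n - real k) * B"
    using binomial_absorb_comp[of n k] k n unfolding A_def B_def
    by (metis (no_types, lifting) diff_Suc_1 le_SucI of_nat_diff of_nat_mult)
  then have B: "B = real n * A / (real n - real k)" using k n by (simp add: field_simps)
  \<comment> \<open>the recurrence of Leibniz' harmonic triangle\<close>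
  have eq: "d / real (Suc k * (n choose Suc k)) =
            d / real (k * (n' choose k)) - d / real (k * (n choose k))"
    unfolding of_nat_mult 1 A_def[symmetric] B_def[symmetric] unfolding B
    using k n pos by (simp add: divide_simps) (simp add: algebra_simps)
  have "d / real (k * (n' choose k)) \<in> \<int>" "d / real (k * (n choose k)) \<in> \<int>"
    using Suc.IH[of n'] Suc.IH[of n] Ints_iff k n Suc.prems by auto
  then have "d / real (Suc k * (n choose Suc k)) \<in> \<int>"
    unfolding eq by (rule Ints_diff)
  then show ?case using Ints_iff Suc.prems by (metis nat_0_less_mult_iff zero_less_Suc zero_less_binomial_iff)
qed

text \<open>The multiplicity of \<open>p\<close> in an lcm is the maximum over its arguments, each
  of which is at most \<open>n\<close>.\<close>

lemma power_multiplicity_Lcm_le: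
  fixes p n :: nat
  assumes "prime p" "n \<ge> 1"
  shows "p ^ multiplicity p (Lcm {1..n}) \<le> n"
  using assms(2)
proof (induction n rule: nat_induct_at_least)
  case base
  then show ?case by simp
next
  case (Suc n)
  have "multiplicity p (Lcm {1..Suc n}) = max (multiplicity p (Suc n)) (multiplicity p (Lcm {1..n}))"
    using assms(1) by (simp add: atLeastAtMostSuc_conv multiplicity_lcm Lcm_0_iff)
  moreover have "p ^ multiplicity p (Suc n) \<le> Suc n"
    by (intro dvd_imp_le multiplicity_dvd) auto
  ultimately show ?case using Suc by (simp add: max_def)
qed

text \<open>Every prime power in the factorisation is at most \<open>n\<close>, and only primes up
  to \<open>n\<close> occur.\<close>

lemma Lcm_le_power_card_primes:
  fixes n :: nat
  assumes "n \<ge> 1"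
  shows "Lcm {1..n} \<le> n ^ card {p. prime p \<and> p \<le> n}"
proof -
  let ?L = "Lcm {1..n}"
  have nz: "?L \<noteq> 0" by (simp add: Lcm_0_iff)
  have sub: "prime_factors ?L \<subseteq> {p. prime p \<and> p \<le> n}"
  proof
    fix p assume p: "p \<in> prime_factors ?L"
    then have pr: "prime p" by auto
    have "multiplicity p ?L \<ge> 1"
      using p nz by (simp add: prime_factors_multiplicity)
    then have "p ^ 1 \<le> p ^ multiplicity p ?L"
      using prime_gt_0_nat[OF pr] by (intro power_increasing) auto
    with power_multiplicity_Lcm_le[OF pr assms] pr
    show "p \<in> {p. prime p \<and> p \<le> n}" by simp
  qed
  have fin: "finite {p. prime p \<and> p \<le> n}" by simp
  have "?L = (\<Prod>p\<in>prime_factors ?L. p ^ multiplicity p ?L)"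
    using prod_prime_factors[OF nz] by simp
  also have "\<dots> \<le> (\<Prod>p\<in>prime_factors ?L. n)"
    by (rule prod_mono) (use power_multiplicity_Lcm_le[OF _ assms] in auto)
  also have "\<dots> = n ^ card (prime_factors ?L)" by simp
  also have "\<dots> \<le> n ^ card {p. prime p \<and> p \<le> n}"
    using assms by (intro power_increasing card_mono fin sub) auto
  finally show ?thesis .
qed

text \<open>Row \<open>n\<close> of Pascal's triangle sums to \<open>2 ^ n\<close>, and each of its
  \<open>n + 1\<close> entries is bounded via the lcm.\<close>

lemma two_power_le_power_card_primes:
  fixes n :: nat
  assumes "n \<ge> 1"
  shows "2 ^ n \<le> (n + 1) * n ^ card {p. prime p \<and> p \<le> n}"
proof -
  let ?M = "n ^ card {p. prime p \<and> p \<le> n}"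
  have "n choose k \<le> ?M" if "k \<le> n" for k
  proof (cases "k = 0")
    case True
    then show ?thesis using assms by simp
  next
    case False
    then have "k * (n choose k) dvd Lcm {1..n}"
      using that by (intro mult_choose_dvd_Lcm) auto
    then have "(n choose k) dvd Lcm {1..n}" by (rule dvd_mult_right)
    moreover have "Lcm {1..n} \<noteq> 0" by (simp add: Lcm_0_iff)
    ultimately have "n choose k \<le> Lcm {1..n}" by (intro dvd_imp_le) (auto intro: gr0I)
    with Lcm_le_power_card_primes[OF assms] show ?thesis by simp
  qed
  then have "(\<Sum>k\<le>n. n choose k) \<le> (\<Sum>k\<le>n. ?M)" by (intro sum_mono) auto
  then show ?thesis by (simp add: choose_row_sum)
qed

section \<open>Bounds for the n-th prime\<close>

lemma nth_prime_prime: "prime (nth_prime n)"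
  using enumerate_in_set[OF primes_infinite] by (simp add: nth_prime_def)

lemma nth_prime_mono: "m \<le> n \<Longrightarrow> nth_prime m \<le> nth_prime n"
  unfolding nth_prime_def
  by (intro strict_mono_leD[OF strict_mono_enumerate] primes_infinite) simp

lemma nth_prime_gt: "nth_prime n > n"
proof (induction n)
  case 0
  then show ?case using nth_prime_prime prime_gt_0_nat by blast
next
  case (Suc n)
  show ?case
  \<comment> \<open>Truncated subtraction makes \<open>nth_prime 0\<close> equal to
    \<open>nth_prime 1\<close>, so strict growth starts only at index 1.\<close>
  proof (cases "n = 0")
    case True
    then show ?thesis using prime_gt_1_nat[OF nth_prime_prime] by simp
  next
    case False
    then have "nth_prime n < nth_prime (Suc n)"
      unfolding nth_prime_def by (intro enumerate_mono primes_infinite) simp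
    with Suc show ?thesis by simp
  qed
qed

lemma card_primes_le_nth_prime:
  assumes "n \<ge> 1"
  shows "card {p. prime p \<and> p \<le> nth_prime n} \<le> n"
proof -
  have "{p. prime p \<and> p \<le> nth_prime n} \<subseteq> enumerate {p. prime p} ` {..<n}"
  proof
    fix p :: nat assume p: "p \<in> {p. prime p \<and> p \<le> nth_prime n}"
    then obtain i where i: "p = enumerate {p. prime p} i"
      using enumerate_Ex[of "{p. prime p}" p] primes_infinite by auto
    have "i \<le> n - 1"
      using p primes_infinite by (simp add: i nth_prime_def enumerate_mono_le_iff)
    with assms i show "p \<in> enumerate {p. prime p} ` {..<n}" by auto
  qed
  then have "card {p. prime p \<and> p \<le> nth_prime n} \<le> card {..<n}"
    by (meson card_image_le card_mono finite_imageI finite_lessThan le_trans)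
  then show ?thesis by simp
qed

text \<open>Taking logarithms in \<open>2 ^ q \<le> (q + 1) ^ Suc n\<close> bounds \<open>q\<close>
  by \<open>3 * n * ln (q + 1)\<close>; a crude polynomial bound on \<open>q + 1\<close> then
  replaces this logarithm by one in \<open>n\<close>.\<close>

lemma nth_prime_le:
  assumes "n \<ge> 1"
  shows "real (nth_prime n) \<le> 3 * real n * (ln 49 + 2 * ln (real n))"
proof -
  define q where "q = nth_prime n"
  define x where "x = real q + 1"
  have q: "q \<ge> 2" using prime_ge_2_nat[OF nth_prime_prime] by (simp add: q_def)
  have x: "x \<ge> 3" using q by (simp add: x_def)
  have "2 ^ q \<le> (q + 1) * q ^ card {p. prime p \<and> p \<le> q}"
    using q by (intro two_power_le_power_card_primes) simp
  also have "\<dots> \<le> (q + 1) * (q + 1) ^ n"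
    using card_primes_le_nth_prime[OF assms] q unfolding q_def[symmetric]
    by (intro mult_left_mono order.trans[OF power_increasing power_mono]) auto
  finally have "2 ^ q \<le> (q + 1) ^ Suc n" by simp
  then have "(2::real) ^ q \<le> x ^ Suc n"
    unfolding x_def by (metis of_nat_Suc of_nat_le_iff of_nat_numeral of_nat_power Suc_eq_plus1 add.commute)
  then have "ln ((2::real) ^ q) \<le> ln (x ^ Suc n)" using x by (subst ln_le_cancel_iff) auto
  then have 1: "real q * ln 2 \<le> real (Suc n) * ln x" using x by (simp only: ln_realpow)
  have lnx: "ln x > 0" using x by simp
  have "real q * (2/3) \<le> real q * ln 2"
    using ln2_ge_two_thirds by (intro mult_left_mono) auto
  also note 1
  also have "real (Suc n) * ln x \<le> (2 * real n) * ln x"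
    using assms lnx by (intro mult_right_mono) auto
  finally have 2: "real q \<le> 3 * real n * ln x" by simp
  \<comment> \<open>Bootstrapping: \<open>ln x \<le> 2 * sqrt x\<close> turns the implicit bound
    into \<open>sqrt x \<le> 7 * n\<close>, hence \<open>ln x \<le> ln (49 * n ^ 2)\<close>.\<close>
  define s where "s = sqrt x"
  have s: "s \<ge> 1" "x = s\<^sup>2" using x by (auto simp: s_def)
  have "ln x = 2 * ln s" using s by (simp add: ln_realpow)
  also have "\<dots> \<le> 2 * s" using s ln_bound[of s] by simp
  finally have "ln x \<le> 2 * s" .
  then have "3 * real n * ln x \<le> 3 * real n * (2 * s)" by (intro mult_left_mono) auto
  with 2 have "real q \<le> 6 * real n * s" by linarith
  then have "s\<^sup>2 \<le> 6 * real n * s + 1" using s(2) by (simp add: x_def)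
  moreover have "1 * 1 \<le> real n * s" using assms s by (intro mult_mono) auto
  ultimately have "s * s \<le> 7 * real n * s" by (simp add: power2_eq_square)
  then have "s \<le> 7 * real n" using s by (simp add: mult_le_cancel_right)
  then have "s\<^sup>2 \<le> (7 * real n)\<^sup>2" using s by (intro power_mono) auto
  then have "ln x \<le> ln (49 * real n ^ 2)"
    using s x assms by (subst ln_le_cancel_iff) (auto simp: power_mult_distrib)
  also have "\<dots> = ln 49 + 2 * ln (real n)" using assms by (simp add: ln_mult ln_realpow)
  finally have "3 * real n * ln x \<le> 3 * real n * (ln 49 + 2 * ln (real n))"
    by (intro mult_left_mono) auto
  with 2 show ?thesis by (simp add: q_def)
qed

text \<open>Any factor above 1 before \<open>ln (ln n)\<close> absorbs the constants;
  \<open>11/10\<close> is small enough that two iterations cost \<open>11/5\<close>, below the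
  \<open>23/10\<close> gained in \<open>growth_step\<close>.\<close>

lemma eventually_ln_nth_prime_le:
  "eventually (\<lambda>n. ln (real (nth_prime n)) \<le> ln (real n) + 11/10 * ln (ln (real n))) at_top"
proof -
  have "eventually (\<lambda>n::nat. ln (3 * real n * (ln 49 + 2 * ln (real n)))
          \<le> ln (real n) + 11/10 * ln (ln (real n))) at_top"
    by real_asymp
  then show ?thesis
    using eventually_ge_at_top[of 1]
  proof eventually_elim
    case (elim n)
    have "nth_prime n > 0" using nth_prime_gt[of n] by simp
    then have "ln (real (nth_prime n)) \<le> ln (3 * real n * (ln 49 + 2 * ln (real n)))"
      using nth_prime_le[of n] elim by (subst ln_le_cancel_iff) auto
    with elim show ?case by simp
  qed
qed

section \<open>Growth of the iterates\<close>

lemma funpow_nth_prime_mono: "m \<le> n \<Longrightarrow> (nth_prime ^^ i) m \<le> (nth_prime ^^ i) n"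
  by (induction i) (auto intro: nth_prime_mono)

lemma funpow_nth_prime_ge: "n + i \<le> (nth_prime ^^ i) n"
proof (induction i)
  case (Suc i)
  then show ?case using nth_prime_gt[of "(nth_prime ^^ i) n"] by simp
qed simp

lemma diagonal_le: "iter_prime (k + m) (k + m) \<le> (nth_prime ^^ (2 * m)) (iter_prime k k)"
proof -
  have "(nth_prime ^^ (k + m)) (k + m) \<le> (nth_prime ^^ (k + m)) ((nth_prime ^^ m) k)"
    by (intro funpow_nth_prime_mono funpow_nth_prime_ge)
  also have "\<dots> = (nth_prime ^^ (2 * m + k)) k"
    by (simp add: funpow_add[symmetric, THEN fun_cong, unfolded o_apply] mult_2 add_ac)
  finally show ?thesis by (simp add: iter_prime_def funpow_add)
qed

text \<open>Here \<open>L\<close> stands for \<open>ln P\<close> and \<open>y\<close> for the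
  inductive bound on the logarithm of the \<open>2m\<close>-fold iterate. Two further iterations
  cost at most \<open>11/5 * ln (2 * y)\<close>, which must fit into the increment of the exponent
  \<open>g\<close>.\<close>

lemma growth_step:
  fixes L :: real and m :: nat
  defines "g \<equiv> \<lambda>m::nat. 2 * real (m + 1) * ln (real (m + 1))"
  assumes L: "ln L \<ge> 88" "L \<ge> 1"
  defines "y \<equiv> L + g m * ln L"
  shows "11/5 * ln (2 * y) \<le> (g (Suc m) - g m) * ln L"
proof -
  have lnm: "0 \<le> ln (real (m + 1))" "ln (real (m + 1)) \<le> real m"
    using ln_add_one_self_le_self[of "real m"] by (auto simp: add.commute)
  have g0: "0 \<le> g m" using lnm by (simp add: g_def)
  have "g m \<le> 2 * real (m + 1) * real m"
    unfolding g_def using lnm by (intro mult_left_mono) auto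
  then have g1: "1 + g m \<le> 2 * (real (m + 1))\<^sup>2"
    by (simp add: power2_eq_square algebra_simps)
  have "g m * ln L \<le> g m * L" using g0 L ln_bound[of L] by (intro mult_left_mono) auto
  then have "2 * y \<le> 2 * L * (1 + g m)" by (simp add: y_def algebra_simps)
  also have "\<dots> \<le> 2 * L * (2 * (real (m + 1))\<^sup>2)"
    using g1 L by (intro mult_left_mono) auto
  finally have y1: "2 * y \<le> 2 * L * (2 * (real (m + 1))\<^sup>2)" .
  have "y > 0" using g0 L by (simp add: y_def add_pos_nonneg)
  then have "ln (2 * y) \<le> ln (2 * L * (2 * (real (m + 1))\<^sup>2))"
    using y1 by (subst ln_le_cancel_iff) auto
  also have "\<dots> = 2 * ln 2 + ln L + 2 * ln (real (m + 1))"
    using L ln_realpow[of 2 2] by (simp add: ln_mult ln_realpow)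
  finally have lhs: "ln (2 * y) \<le> 2 * ln 2 + ln L + 2 * ln (real (m + 1))" .
  \<comment> \<open>The shift by \<open>ln 2\<close> makes \<open>t\<close> vanish at
    \<open>m = 0\<close>, separating a constant gain from one growing with \<open>m\<close>.\<close>
  define t where "t = ln (real (m + 2)) - ln 2"
  have t0: "t \<ge> 0" by (simp add: t_def)
  have "ln (real (m + 1)) \<le> ln (real (m + 2))" by simp
  then have lnt: "ln (real (m + 1)) \<le> t + ln 2" by (simp add: t_def)
  have "ln (real (m + 1) / real (m + 2)) \<le> real (m + 1) / real (m + 2) - 1"
    by (rule ln_le_minus_one) simp
  then have "ln (real (m + 2)) - ln (real (m + 1)) \<ge> 1 / real (m + 2)"
    by (simp add: ln_div field_simps)
  then have "real (m + 1) * (ln (real (m + 2)) - ln (real (m + 1))) \<ge> real (m + 1) * (1 / real (m + 2))"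
    by (intro mult_left_mono) auto
  moreover have "real (m + 1) * (1 / real (m + 2)) \<ge> 1/2" by (simp add: field_simps)
  moreover have "g (Suc m) - g m = 2 * ln (real (m + 2)) +
      2 * (real (m + 1) * (ln (real (m + 2)) - ln (real (m + 1))))"
    by (simp add: g_def algebra_simps)
  ultimately have "g (Suc m) - g m \<ge> 2 * ln (real (m + 2)) + 1"
    by linarith
  \<comment> \<open>The constant is \<open>2 * ln 2 + 1\<close>, at least
    \<open>7/3\<close>.\<close>
  then have "g (Suc m) - g m \<ge> 2 * t + 23/10"
    using ln2_ge_two_thirds by (simp add: t_def)
  then have rhs: "(2 * t + 23/10) * ln L \<le> (g (Suc m) - g m) * ln L"
    using L by (intro mult_right_mono) auto
  \<comment> \<open>The threshold 88 is chosen so that the surplus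
    \<open>(23/10 - 11/5) * ln L\<close> covers the constant \<open>11/5 * 4 * ln 2\<close>, with
    \<open>ln 2\<close> estimated by 1.\<close>
  have "t * 88 \<le> t * ln L" using t0 L by (intro mult_left_mono) auto
  moreover have "ln 2 \<le> (1::real)" using ln_le_minus_one[of 2] by simp
  ultimately have "11/5 * (2 * ln 2 + ln L + 2 * (t + ln 2)) \<le> (2 * t + 23/10) * ln L"
    using L t0 by (simp add: algebra_simps)
  with lhs lnt rhs show ?thesis by argo
qed

text \<open>Induction in blocks of two iterations: the first at most doubles \<open>y\<close>, so
  both cost at most \<open>11/10 * ln (2 * y)\<close>, and \<open>growth_step\<close> pays for the
  pair.\<close>

lemma ln_funpow_nth_prime_le:
  fixes P N m :: nat
  assumes N: "\<And>n. n \<ge> N \<Longrightarrow> ln (real (nth_prime n)) \<le> ln (real n) + 11/10 * ln (ln (real n))"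
    and P: "P \<ge> N" and L: "ln (ln (real P)) \<ge> 88" "ln (real P) \<ge> 1"
  shows "ln (real ((nth_prime ^^ (2 * m)) P))
      \<le> ln (real P) + 2 * real (m + 1) * ln (real (m + 1)) * ln (ln (real P))"
proof (induction m)
  case 0
  then show ?case by simp
next
  case (Suc m)
  define L where "L = ln (real P)"
  define g where "g = (\<lambda>m::nat. 2 * real (m + 1) * ln (real (m + 1)))"
  define q where "q = (nth_prime ^^ (2 * m)) P"
  \<comment> \<open>Since \<open>ln 0 = 0\<close>, the lower bound on \<open>ln P\<close> excludes
    \<open>P = 0\<close>.\<close>
  have "P > 0" using L by (cases P) auto
  have q: "q \<ge> P" "nth_prime q \<ge> P"
    using funpow_nth_prime_ge[of P "2 * m"] nth_prime_gt[of q] by (auto simp: q_def)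
  have IH: "ln (real q) \<le> L + g m * ln L" using Suc by (simp add: q_def L_def g_def)
  have lq: "ln (real q) \<ge> L" unfolding L_def using q \<open>P > 0\<close> by (subst ln_le_cancel_iff) auto
  have lq': "ln (real (nth_prime q)) \<ge> L"
    unfolding L_def using q \<open>P > 0\<close> by (subst ln_le_cancel_iff) auto
  have L1: "L \<ge> 1" using L by (simp add: L_def)
  define y where "y = L + g m * ln L"
  have ly: "ln (real q) \<le> y" using IH by (simp add: y_def)
  have y1: "y \<ge> 1" using ly lq L1 by simp
  have "11/10 * ln y \<le> y"
  proof -
    show ?thesis
    proof (cases "y \<ge> 88")
      case True
      have "ln (y / 2) \<le> y / 2 - 1" using y1 by (intro ln_le_minus_one) auto
      moreover have "ln 2 \<le> (1::real)" using ln_le_minus_one[of 2] by simp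
      ultimately have "ln y \<le> y / 2" using y1 by (simp add: ln_div)
      then show ?thesis using True by simp
    \<comment> \<open>This case is contradictory, as
      \<open>y \<ge> L \<ge> ln L \<ge> 88\<close>.\<close>
    next
      case False
      have "88 \<le> ln L" using L by (simp add: L_def)
      also have "\<dots> \<le> L" using L1 ln_bound[of L] by simp
      finally show ?thesis using False lq ly by simp
    qed
  qed
  have s1: "ln (real (nth_prime q)) \<le> ln (real q) + 11/10 * ln (ln (real q))"
    using N q P by simp
  have "ln (ln (real q)) \<le> ln y" using ly lq L1 by (subst ln_le_cancel_iff) auto
  then have s1': "ln (real (nth_prime q)) \<le> y + 11/10 * ln y" using s1 ly by simp
  with \<open>11/10 * ln y \<le> y\<close> have "ln (real (nth_prime q)) \<le> 2 * y" by simp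
  then have s2': "ln (ln (real (nth_prime q))) \<le> ln (2 * y)"
    using lq' L1 y1 by (subst ln_le_cancel_iff) auto
  have s2: "ln (real (nth_prime (nth_prime q)))
      \<le> ln (real (nth_prime q)) + 11/10 * ln (ln (real (nth_prime q)))"
    using N q P by simp
  have "ln y \<le> ln (2 * y)" using y1 by (subst ln_le_cancel_iff) auto
  with s1' s2 s2' have "ln (real (nth_prime (nth_prime q))) \<le> y + 11/5 * ln (2 * y)"
    by simp
  also have "\<dots> \<le> y + (g (Suc m) - g m) * ln L"
    using growth_step[of L m] L by (simp add: L_def g_def y_def)
  also have "\<dots> = L + g (Suc m) * ln L" by (simp add: y_def algebra_simps)
  finally show ?case by (simp add: q_def L_def g_def)
qed

theorem theorem14:
  shows "\<exists>k0::nat. \<forall>k j::nat. k0 \<le> k \<and> k \<le> j \<longrightarrow>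
    real (iter_prime j j) \<le> real (iter_prime k k) *
      ln (real (iter_prime k k)) powr
        (2 * real (j - k + 1) * ln (real (j - k + 1)))"
proof -
  have "eventually (\<lambda>n::nat. ln (ln (real n)) \<ge> 88 \<and> ln (real n) \<ge> 1) at_top"
    by (intro eventually_conj) real_asymp+
  with eventually_ln_nth_prime_le
  have "eventually (\<lambda>n::nat. ln (real (nth_prime n)) \<le> ln (real n) + 11/10 * ln (ln (real n)) \<and>
      ln (ln (real n)) \<ge> 88 \<and> ln (real n) \<ge> 1) at_top"
    by (rule eventually_conj)
  then obtain N where N: "\<And>n. n \<ge> N \<Longrightarrow>
      ln (real (nth_prime n)) \<le> ln (real n) + 11/10 * ln (ln (real n)) \<and>
      ln (ln (real n)) \<ge> 88 \<and> ln (real n) \<ge> 1"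
    by (auto simp: eventually_at_top_linorder)
  show ?thesis
  proof (intro exI[of _ N] allI impI)
    fix k j :: nat assume "N \<le> k \<and> k \<le> j"
    then obtain m where j: "j = k + m" and k: "N \<le> k" using le_Suc_ex by blast
    define P where "P = iter_prime k k"
    define E where "E = 2 * real (m + 1) * ln (real (m + 1))"
    have P: "P \<ge> N" using k funpow_nth_prime_ge[of k k] by (simp add: P_def iter_prime_def)
    have L: "ln (real P) \<ge> 1" using N P by blast
    then have "P > 0" by (cases P) auto
    \<comment> \<open>This keeps the base \<open>ln P\<close> nonzero, so that \<open>powr\<close>
      unfolds to an exponential.\<close>
    have "P \<noteq> Suc 0" using L by auto
    have "ln (real ((nth_prime ^^ (2 * m)) P)) \<le> ln (real P) + E * ln (ln (real P))"
      unfolding E_def using N P by (intro ln_funpow_nth_prime_le[of N]) auto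
    then have "exp (ln (real ((nth_prime ^^ (2 * m)) P))) \<le> exp (ln (real P) + E * ln (ln (real P)))"
      by simp
    then have "real ((nth_prime ^^ (2 * m)) P) \<le> exp (ln (real P) + E * ln (ln (real P)))"
      using funpow_nth_prime_ge[of P "2 * m"] \<open>P > 0\<close> by (subst (asm) exp_ln) auto
    also have "\<dots> = real P * ln (real P) powr E"
      using \<open>P > 0\<close> \<open>P \<noteq> Suc 0\<close> by (simp add: exp_add powr_def)
    finally have "real ((nth_prime ^^ (2 * m)) P) \<le> real P * ln (real P) powr E" .
    moreover have "real (iter_prime j j) \<le> real ((nth_prime ^^ (2 * m)) P)"
      using diagonal_le[of k m] by (simp add: j P_def)
    ultimately show "real (iter_prime j j) \<le> real (iter_prime k k) *
      ln (real (iter_prime k k)) powr (2 * real (j - k + 1) * ln (real (j - k + 1)))"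
      unfolding P_def E_def j by (simp del: of_nat_add of_nat_Suc)
  qed
qed

end
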